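(* Let $I\subset\mathbb{N}$ be a finite index set, let $X_i$ ($i\in I$) be real random variables, all continuous with probability density functions $f_{X_i}$ or all discrete with probability mass functions $f_{X_i}$, and let $A_i\in\mathbb{R}$ ($i\in I$) with $\sum_{i\in I}A_i=1$. Let $Y$ be a random variable (of the same type) whose density (respectively mass function) is $$f_Y(t)=\sum_{i\in I}A_i f_{X_i}(t).$$ Then the hazard rate function of $Y$ is $$h_Y(t)=\frac{\sum_{i\in I}A_if_{X_i}(t)}{\sum_{i\in I}A_iR_{X_i}(t)}$$ for every $t\in\mathbb{R}$ with $R_Y(t)>0$.
   Context: The reliability function of a real random variable $X$ is $R_X(t)=P(X>t)$, and its hazard rate function is $h_X(t)=f_X(t)/R_X(t)$, defined where $R_X(t)>0$; here $f_X$ is the probability density function (continuous case) or probability mass function (discrete case). The coefficients $A_i$ may be negative. *)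

theory Defs
  imports "HOL-Probability.Probability"
begin

definition reliability :: "'a measure \<Rightarrow> ('a \<Rightarrow> real) \<Rightarrow> real \<Rightarrow> real" where
  "reliability M X t = \<P>(x in M. X x > t)"

(* A density is determined only up to a Lebesgue null set, so nonnegativity is
   required only almost everywhere. *)
definition has_pdf :: "'a measure \<Rightarrow> ('a \<Rightarrow> real) \<Rightarrow> (real \<Rightarrow> real) \<Rightarrow> bool" where
  "has_pdf M X f \<longleftrightarrow>
     f \<in> borel_measurable borel \<and> (AE t in lborel. 0 \<le> f t) \<and>
     distributed M lborel X (\<lambda>t. ennreal (f t))"

definition has_pmf :: "'a measure \<Rightarrow> ('a \<Rightarrow> real) \<Rightarrow> (real \<Rightarrow> real) \<Rightarrow> bool" where
  "has_pmf M X f \<longleftrightarrow>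
     X \<in> borel_measurable M \<and>
     (\<exists>S. countable S \<and> (AE x in M. X x \<in> S)) \<and>
     (\<forall>t. f t = \<P>(x in M. X x = t))"

(* The density or mass function f is an argument because in the continuous case
   it is not determined by X. The value is meaningful only where the reliability
   is positive. *)
definition hazard_rate ::
  "'a measure \<Rightarrow> ('a \<Rightarrow> real) \<Rightarrow> (real \<Rightarrow> real) \<Rightarrow> real \<Rightarrow> real" where
  "hazard_rate M X f t = f t / reliability M X t"

end

theory Submission
  imports Defs
begin

text \<open>
  In both cases the reliability at \<open>t\<close> is the integral over \<open>{t<..}\<close> of the density or mass function
  with respect to a reference measure that does not depend on the random variable: Lebesgue measure,
  or counting measure on the union of the finitely many countable supports. By linearity of the
  integral, reliability functions mix with the same coefficients \<open>A i\<close> as the densities.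
\<close>

text \<open>The law of \<open>X\<close> on \<open>{t<..}\<close> comes as a nonnegative integral of
  the density; almost everywhere nonnegativity turns it into a Bochner integral. This form carries
  integrability along with the value, so combinations with negative coefficients are legitimate
  later.\<close>

lemma has_bochner_integral_reliability_pdf:
  assumes "prob_space M" "has_pdf M X f"
  shows "has_bochner_integral lborel (\<lambda>x. f x * indicator {t<..} x) (reliability M X t)"
proof (rule has_bochner_integral_nn_integral)
  interpret prob_space M by fact
  have [measurable]: "f \<in> borel_measurable borel"
    and nonneg: "AE x in lborel. 0 \<le> f x"
    and dist: "distributed M lborel X (\<lambda>x. ennreal (f x))"
    using assms(2) by (auto simp: has_pdf_def)
  show "(\<lambda>x. f x * indicator {t<..} x) \<in> borel_measurable lborel" by measurable
  show "AE x in lborel. 0 \<le> f x * indicator {t<..} x"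
    using nonneg by eventually_elim simp
  show "0 \<le> reliability M X t" by (simp add: reliability_def)
  have "(\<integral>\<^sup>+x. ennreal (f x * indicator {t<..} x) \<partial>lborel)
      = (\<integral>\<^sup>+x. ennreal (f x) * indicator {t<..} x \<partial>lborel)"
    by (intro nn_integral_cong) (simp split: split_indicator)
  also have "\<dots> = emeasure M (X -` {t<..} \<inter> space M)"
    using distributed_emeasure[OF dist, of "{t<..}"] by simp
  also have "X -` {t<..} \<inter> space M = {x \<in> space M. X x > t}" by auto
  finally show "(\<integral>\<^sup>+x. ennreal (f x * indicator {t<..} x) \<partial>lborel) = ennreal (reliability M X t)"
    by (simp add: reliability_def emeasure_eq_measure)
qed

text \<open>\<open>C\<close> is any countable set that carries \<open>X\<close>, not one chosen for
  \<open>X\<close>, so that several variables can share one reference measure. Shrinking the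
  counting measure to \<open>C \<inter> {t<..}\<close> takes the place of the indicator.\<close>

lemma has_bochner_integral_reliability_pmf:
  assumes "prob_space M" "has_pmf M X f" "countable C" "AE x in M. X x \<in> C"
  shows "has_bochner_integral (count_space (C \<inter> {t<..})) f (reliability M X t)"
proof (rule has_bochner_integral_nn_integral)
  interpret prob_space M by fact
  have [measurable]: "X \<in> borel_measurable M" and f: "\<And>x. f x = prob {y \<in> space M. X y = x}"
    using assms(2) by (auto simp: has_pmf_def)
  have [measurable]: "C \<inter> {t<..} \<in> sets borel"
    by (rule sets.countable) (auto simp: assms(3))
  show "f \<in> borel_measurable (count_space (C \<inter> {t<..}))" by simp
  show "AE x in count_space (C \<inter> {t<..}). 0 \<le> f x" by (simp add: f)
  show "0 \<le> reliability M X t" by (simp add: reliability_def)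
  have single: "emeasure (distr M borel X) {x} = ennreal (f x)" for x
    by (simp add: emeasure_distr f emeasure_eq_measure vimage_def Int_def conj_commute)
  \<comment> \<open>Countable additivity: a countable set has as its measure the sum of its point
    masses.\<close>
  have "(\<integral>\<^sup>+x. ennreal (f x) \<partial>count_space (C \<inter> {t<..})) = emeasure (distr M borel X) (C \<inter> {t<..})"
    by (subst emeasure_countable_singleton) (auto simp: single assms(3))
  also have "\<dots> = emeasure M (X -` (C \<inter> {t<..}) \<inter> space M)"
    by (simp add: emeasure_distr)
  \<comment> \<open>Dropping \<open>C\<close> changes the event only on a null set.\<close>
  also have "\<dots> = emeasure M {x \<in> space M. X x > t}"
  proof (rule emeasure_eq_AE)
    show "AE x in M. (x \<in> X -` (C \<inter> {t<..}) \<inter> space M) = (x \<in> {x \<in> space M. X x > t})"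
      using assms(4) by eventually_elim auto
  qed measurable
  finally show "(\<integral>\<^sup>+x. ennreal (f x) \<partial>count_space (C \<inter> {t<..})) = ennreal (reliability M X t)"
    by (simp add: reliability_def emeasure_eq_measure)
qed

theorem corollary1:
  fixes I :: "nat set"
    and M :: "nat \<Rightarrow> 'a measure" and X :: "nat \<Rightarrow> 'a \<Rightarrow> real"
    and f :: "nat \<Rightarrow> real \<Rightarrow> real" and A :: "nat \<Rightarrow> real"
    and N :: "'b measure" and Y :: "'b \<Rightarrow> real" and fY :: "real \<Rightarrow> real"
  assumes "finite I"
    and "\<And>i. i \<in> I \<Longrightarrow> prob_space (M i)"
    and "prob_space N"
    and "((\<forall>i\<in>I. has_pdf (M i) (X i) (f i)) \<and> has_pdf N Y fY) \<or>
         ((\<forall>i\<in>I. has_pmf (M i) (X i) (f i)) \<and> has_pmf N Y fY)"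
    and "(\<Sum>i\<in>I. A i) = 1"
    and "\<And>t. fY t = (\<Sum>i\<in>I. A i * f i t)"
  shows "\<forall>t. reliability N Y t > 0 \<longrightarrow>
           (\<Sum>i\<in>I. A i * reliability (M i) (X i) t) \<noteq> 0 \<and>
           hazard_rate N Y fY t =
             (\<Sum>i\<in>I. A i * f i t) / (\<Sum>i\<in>I. A i * reliability (M i) (X i) t)"
proof (intro allI impI)
  fix t assume pos: "reliability N Y t > 0"
  have mix: "reliability N Y t = (\<Sum>i\<in>I. A i * reliability (M i) (X i) t)"
    using assms(4)
  proof
    assume pdf: "(\<forall>i\<in>I. has_pdf (M i) (X i) (f i)) \<and> has_pdf N Y fY"
    have "has_bochner_integral lborel
        (\<lambda>x. \<Sum>i\<in>I. A i * (f i x * indicator {t<..} x)) (\<Sum>i\<in>I. A i * reliability (M i) (X i) t)"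
      using pdf assms(2)
      by (intro has_bochner_integral_sum has_bochner_integral_mult_right
          has_bochner_integral_reliability_pdf) auto
    then have "has_bochner_integral lborel
        (\<lambda>x. fY x * indicator {t<..} x) (\<Sum>i\<in>I. A i * reliability (M i) (X i) t)"
      by (simp add: assms(6) sum_distrib_right mult.assoc)
    \<comment> \<open>Both values belong to the integral of the same function, hence agree. The
      nonnegativity of \<open>fY\<close> comes from \<open>has_pdf N Y fY\<close>; the signs of the
      \<open>A i\<close> would not give it.\<close>
    then show ?thesis
      using pdf by (intro has_bochner_integral_eq[OF has_bochner_integral_reliability_pdf[OF assms(3)]]) auto
  next
    assume pmf: "(\<forall>i\<in>I. has_pmf (M i) (X i) (f i)) \<and> has_pmf N Y fY"
    then have "\<forall>i\<in>I. \<exists>S. countable S \<and> (AE x in M i. X i x \<in> S)"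
      by (auto simp: has_pmf_def)
    then obtain S where S: "\<forall>i\<in>I. countable (S i) \<and> (AE x in M i. X i x \<in> S i)"
      by metis
    obtain S' where S': "countable S'" "AE x in N. Y x \<in> S'"
      using pmf by (auto simp: has_pmf_def)
    \<comment> \<open>Including \<open>S'\<close> makes \<open>C\<close> carry \<open>Y\<close> at
      once, without deducing from the mixture formula where the mass of \<open>Y\<close> sits.
      Countability of the union uses that \<open>I\<close> is finite.\<close>
    define C where "C = S' \<union> (\<Union>i\<in>I. S i)"
    have C: "countable C" "AE x in N. Y x \<in> C"
      using S S' assms(1) by (auto simp: C_def countable_finite elim: eventually_mono)
    have CI: "AE x in M i. X i x \<in> C" if "i \<in> I" for i
    proof -
      have "AE x in M i. X i x \<in> S i" using S that by blast
      then show ?thesis by (rule eventually_mono) (use that in \<open>auto simp: C_def\<close>)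
    qed
    have "has_bochner_integral (count_space (C \<inter> {t<..}))
        (\<lambda>x. \<Sum>i\<in>I. A i * f i x) (\<Sum>i\<in>I. A i * reliability (M i) (X i) t)"
      using pmf assms(2) C CI
      by (intro has_bochner_integral_sum has_bochner_integral_mult_right
          has_bochner_integral_reliability_pmf) auto
    then have "has_bochner_integral (count_space (C \<inter> {t<..}))
        fY (\<Sum>i\<in>I. A i * reliability (M i) (X i) t)"
      by (simp add: assms(6)[abs_def])
    then show ?thesis
      using pmf C by (intro has_bochner_integral_eq[OF has_bochner_integral_reliability_pmf[OF assms(3)]]) auto
  qed
  \<comment> \<open>By \<open>mix\<close> the denominator is the reliability of \<open>Y\<close>
    itself, so signed terms cannot cancel to zero here and the quotient is a genuine
    division.\<close>
  with pos show "(\<Sum>i\<in>I. A i * reliability (M i) (X i) t) \<noteq> 0 \<and>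
      hazard_rate N Y fY t =
        (\<Sum>i\<in>I. A i * f i t) / (\<Sum>i\<in>I. A i * reliability (M i) (X i) t)"
    by (simp add: hazard_rate_def assms(6))
qed

end
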